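(* Let $f:\{n\in\mathbb{N}: n\ge 2\}\to(1,\infty)$ be an increasing and unbounded function. Then there exists an infinite family of measures $\mu$ on $[0,1)$, each of which is $n$-adic doubling with $n$-adic doubling constant at most $f(n)$ for every integer $n\ge 2$, but is not doubling.
   Context: All intervals are bounded, half-open, containing their left endpoint, of positive length, and here are contained in $[0,1)$. A measure $\mu$ on $[0,1)$ is doubling if there is a constant $C>0$ (depending only on $\mu$) such that $\mu(I_1)\le C\mu(I_2)$ for any two adjacent intervals $I_1,I_2\subseteq[0,1)$ of equal length. For an integer $n\ge 2$, an $n$-adic interval is an interval $\left[\frac{k-1}{n^m},\frac{k}{n^m}\right)$ with $m,k\in\mathbb{Z}$ (here contained in $[0,1)$). Its $n$ children are $\left[\frac{k-1}{n^m}+\frac{j-1}{n^{m+1}},\frac{k-1}{n^m}+\frac{j}{n^{m+1}}\right)$, $1\le j\le n$. Two $n$-adic intervals are $n$-adic siblings if they are children of a common $n$-adic interval in $[0,1)$. A measure $\mu$ is $n$-adic doubling with constant $C(n)$ if $\mu(J_1)\le C(n)\mu(J_2)$ for all $n$-adic siblings $J_1,J_2$. *)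

theory Defs
  imports "HOL-Analysis.Analysis"
begin

text \<open>
  Measures on \<open>[0,1)\<close> are Borel measures with values in \<open>[0,\<infinity>]\<close>.  Finiteness is not required in
  the definition: a measure that is \<open>n\<close>-adic doubling for some \<open>n \<ge> 2\<close> and has infinite total mass
  gives infinite mass to every interval, and is then doubling.
\<close>

definition measure_on_unit :: "real measure \<Rightarrow> bool" where
  "measure_on_unit \<mu> \<longleftrightarrow> sets \<mu> = sets (restrict_space borel {0..<1})"

definition adjacent_equal_length :: "real set \<Rightarrow> real set \<Rightarrow> bool" where
  "adjacent_equal_length I\<^sub>1 I\<^sub>2 \<longleftrightarrow>
     (\<exists>a b c. a < b \<and> b < c \<and> b - a = c - b \<and>
        (I\<^sub>1 = {a..<b} \<and> I\<^sub>2 = {b..<c} \<or> I\<^sub>1 = {b..<c} \<and> I\<^sub>2 = {a..<b}))"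

definition doubling :: "real measure \<Rightarrow> bool" where
  "doubling \<mu> \<longleftrightarrow>
     (\<exists>C::real. C > 0 \<and>
        (\<forall>I\<^sub>1 I\<^sub>2. I\<^sub>1 \<subseteq> {0..<1} \<longrightarrow> I\<^sub>2 \<subseteq> {0..<1} \<longrightarrow> adjacent_equal_length I\<^sub>1 I\<^sub>2 \<longrightarrow>
           emeasure \<mu> I\<^sub>1 \<le> ennreal C * emeasure \<mu> I\<^sub>2))"

definition nadic_interval :: "nat \<Rightarrow> int \<Rightarrow> int \<Rightarrow> real set" where
  "nadic_interval n m k =
     {(of_int k - 1) / real n powi m ..< of_int k / real n powi m}"

definition nadic_child :: "nat \<Rightarrow> int \<Rightarrow> int \<Rightarrow> nat \<Rightarrow> real set" where
  "nadic_child n m k j =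
     {(of_int k - 1) / real n powi m + (real j - 1) / real n powi (m + 1) ..<
      (of_int k - 1) / real n powi m + real j / real n powi (m + 1)}"

definition nadic_siblings :: "nat \<Rightarrow> real set \<Rightarrow> real set \<Rightarrow> bool" where
  "nadic_siblings n J\<^sub>1 J\<^sub>2 \<longleftrightarrow>
     (\<exists>m k. nadic_interval n m k \<subseteq> {0..<1} \<and>
        (\<exists>i\<in>{1..n}. J\<^sub>1 = nadic_child n m k i) \<and>
        (\<exists>j\<in>{1..n}. J\<^sub>2 = nadic_child n m k j))"

definition nadic_doubling_with :: "nat \<Rightarrow> real \<Rightarrow> real measure \<Rightarrow> bool" where
  "nadic_doubling_with n C \<mu> \<longleftrightarrow>
     C > 0 \<and>
     (\<forall>J\<^sub>1 J\<^sub>2. nadic_siblings n J\<^sub>1 J\<^sub>2 \<longrightarrow>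
        emeasure \<mu> J\<^sub>1 \<le> ennreal C * emeasure \<mu> J\<^sub>2)"

end

theory Submission imports Defs begin

text \<open>
  The measure has a density that equals \<open>1\<close> except on tiny dips \<open>[b\<^sub>k, (1 + \<delta>\<^sub>k) b\<^sub>k)\<close>, where \<open>b\<^sub>k\<close> tends to \<open>0\<close>
  rapidly.  On the \<open>k\<close>-th dip the density is a function of \<open>x / b\<^sub>k - 1\<close> that falls to \<open>1 / K\<^sub>k\<close> and
  climbs back to \<open>1\<close>, as a tent with tiny slope on the doubly logarithmic scale.  As \<open>K\<^sub>k\<close> is unbounded,
  comparing the two sides of \<open>b\<^sub>k\<close> shows that the measure is not doubling.

  Let \<open>N\<^sub>k\<close> be such that \<open>f n \<ge> K\<^sub>k\<close> for \<open>n \<ge> N\<^sub>k\<close>.  For such \<open>n\<close> the \<open>k\<close>-th dip is harmless.  For \<open>n < N\<^sub>k\<close>, Dirichlet's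
  simultaneous approximation theorem, applied to multiples of the numbers \<open>1 / ln n\<close>, provides \<open>b\<^sub>k\<close>
  extremely close to a power \<open>n\<^sup>-\<^sup>p\<close> for all these \<open>n\<close> at once.  Children much longer than the dip do not notice it;
  the parents of all other children are shorter than \<open>n\<^sup>-\<^sup>p\<close>, hence do not cross this grid point,
  and on one side of it the density varies slowly.
\<close>

section \<open>Profile and location of a dip\<close>

lemma abs_tent_diff_le:
  fixes u v a :: real
  shows "\<bar>max 0 (min u (a - u)) - max 0 (min v (a - v))\<bar> \<le> \<bar>u - v\<bar>"
  by (auto simp: max_def min_def abs_if)

text \<open>The maximum \<open>m = max (x + \<sigma>) r\<close> is at least \<open>x / 2\<close>.
  Hence the increment \<open>y - x\<close>, taken relative to \<open>m\<close>, is at most twice its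
  size \<open>z\<close> relative to \<open>x\<close>, and
  \<open>1 + 2 * z \<le> (1 + z)\<^sup>2\<close>. Shift and cutoff together at most double distances
  on the logarithmic scale.\<close>

lemma ln_max_shift_le:
  fixes x y r \<sigma> :: real
  assumes "0 < x" "x \<le> y" "0 < r" "\<bar>\<sigma>\<bar> \<le> r / 3"
  shows "ln (max (y + \<sigma>) r) - ln (max (x + \<sigma>) r) \<le> 2 * (ln y - ln x)"
proof -
  have "max (y + \<sigma>) r \<le> max (x + \<sigma>) r * (y / x)\<^sup>2"
  proof -
    define m where "m = max (x + \<sigma>) r"
    have m: "m > 0" "m \<ge> x / 2" "m \<ge> r" "m \<ge> x + \<sigma>" using assms by (auto simp: m_def max_def abs_if split: if_splits)
    have "y + \<sigma> \<le> m + 2 * m * (y - x) / x"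
    proof -
      have "(y - x) * 1 \<le> (y - x) * (2 * m / x)"
        using assms m by (intro mult_left_mono) (auto simp: field_simps)
      then show ?thesis using m by (simp add: algebra_simps)
    qed
    also have "\<dots> \<le> m * (y / x)\<^sup>2"
    proof -
      define z where "z = y / x - 1"
      have "(y - x) / x = z" "y / x = 1 + z" using assms by (auto simp: z_def field_simps)
      moreover have "m + 2 * m * z \<le> m * (1 + z)\<^sup>2" using m by (simp add: power2_eq_square algebra_simps)
      ultimately show ?thesis by (metis times_divide_eq_right)
    qed
    finally have 1: "y + \<sigma> \<le> m * (y / x)\<^sup>2" .
    have "r \<le> m * 1" using m by simp
    also have "\<dots> \<le> m * (y / x)\<^sup>2" using assms m by (intro mult_left_mono) (auto simp: one_le_power)
    finally show ?thesis using 1 by (simp add: m_def)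
  qed
  then have "ln (max (y + \<sigma>) r) \<le> ln (max (x + \<sigma>) r * (y / x)\<^sup>2)"
    using assms by (subst ln_le_cancel_iff) auto
  also have "\<dots> = ln (max (x + \<sigma>) r) + 2 * (ln y - ln x)"
    using assms by (simp add: ln_mult ln_realpow ln_div max_def)
  finally show ?thesis by simp
qed

text \<open>
  The shift \<open>\<sigma>\<close> accounts for the distance between the dip and the nearby \<open>n\<close>-adic grid points, which differ from one \<open>n\<close> to the other.
\<close>

lemma slowly_varying_profile:
  fixes \<eta> K \<Lambda> \<delta> :: real
  assumes "0 < \<eta>" "1 \<le> K" "1 < \<Lambda>" "0 < \<delta>"
  obtains V :: "real \<Rightarrow> real" and r c where
    "0 < r" "r \<le> c" "c \<le> \<delta>" "V \<in> borel_measurable borel"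
    "\<And>t. 1 / K \<le> V t" "\<And>t. V t \<le> 1" "\<And>t. t \<le> r \<or> \<delta> \<le> t \<Longrightarrow> V t = 1" "V c = 1 / K"
    "\<And>\<sigma> x y. \<bar>\<sigma>\<bar> \<le> r / 3 \<Longrightarrow> 0 < x \<Longrightarrow> x \<le> y \<Longrightarrow> y \<le> \<Lambda> * x \<Longrightarrow>
       V (y + \<sigma>) \<le> (1 + \<eta>) * V (x + \<sigma>) \<and> V (x + \<sigma>) \<le> (1 + \<eta>) * V (y + \<sigma>)"
proof -
  \<comment> \<open>Slope of the tent. By \<open>ln_max_shift_le\<close> its argument moves by at
    most \<open>2 * ln \<Lambda>\<close>, so with this slope \<open>ln V\<close> moves by at most
    \<open>ln (1 + \<eta>)\<close>.\<close>
  define s where "s = ln (1 + \<eta>) / (2 * ln \<Lambda>)"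
  have s: "s > 0" and s_lam: "s * (2 * ln \<Lambda>) = ln (1 + \<eta>)" using assms by (auto simp: s_def)
  \<comment> \<open>Width of the tent on the logarithmic scale: its height \<open>Y / 2\<close>
    times the slope is \<open>ln K\<close>. The tent extends from \<open>ln r\<close> to
    \<open>ln \<delta>\<close> and peaks halfway, so \<open>c\<close> is the geometric mean of
    \<open>r\<close> and \<open>\<delta>\<close>.\<close>
  define Y where "Y = 2 * ln K / s"
  have Y: "Y \<ge> 0" "s * (Y / 2) = ln K" using assms s by (auto simp: Y_def)
  define r where "r = \<delta> * exp (- Y)"
  define c where "c = \<delta> * exp (- Y / 2)"
  have r: "r > 0" using assms by (simp add: r_def)
  have ln_r: "ln r = ln \<delta> - Y" "ln c = ln \<delta> - Y / 2" using assms by (auto simp: r_def c_def ln_mult)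
  \<comment> \<open>The cutoff at \<open>r\<close> gives the logarithm a meaning for every real
    \<open>t\<close> and makes \<open>u\<close> vanish for \<open>t \<le> r\<close>.\<close>
  define u where "u = (\<lambda>t. ln (max t r) - ln r)"
  define T where "T = (\<lambda>t. max 0 (min (u t) (Y - u t)))"
  define V where "V = (\<lambda>t. exp (- s * T t))"
  have T_le: "T t \<le> Y / 2" for t using Y by (auto simp: T_def min_def max_def)
  have T_ge: "T t \<ge> 0" for t by (simp add: T_def)
  have K: "1 / K = exp (- (s * (Y / 2)))" using Y assms by (simp add: exp_minus field_simps)
  have rc: "r \<le> c" "c \<le> \<delta>" using assms Y by (auto simp: r_def c_def mult_le_cancel_left1)
  show ?thesis
  proof
    show "0 < r" "r \<le> c" "c \<le> \<delta>" using r rc by auto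
    show "V \<in> borel_measurable borel"
      unfolding V_def T_def u_def by measurable
    show "1 / K \<le> V t" for t
      unfolding K V_def using T_le[of t] s by simp
    show "V t \<le> 1" for t
      unfolding V_def using T_ge[of t] s by simp
    show "V t = 1" if "t \<le> r \<or> \<delta> \<le> t" for t
    proof -
      have "u t = 0 \<or> Y - u t \<le> 0"
      proof (cases "t \<le> r")
        case False
        then have "ln \<delta> \<le> ln t" using that assms by (subst ln_le_cancel_iff) auto
        then show ?thesis using False ln_r by (auto simp: u_def max_def)
      qed (auto simp: u_def max_def)
      then have "T t = 0" using Y by (auto simp: T_def)
      then show ?thesis by (simp add: V_def)
    qed
    have "u c = Y / 2" using rc ln_r by (simp add: u_def max_def)
    then have "T c = Y / 2" using Y by (simp add: T_def)
    then show "V c = 1 / K" by (simp add: V_def K)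
    show "V (y + \<sigma>) \<le> (1 + \<eta>) * V (x + \<sigma>) \<and> V (x + \<sigma>) \<le> (1 + \<eta>) * V (y + \<sigma>)"
      if "\<bar>\<sigma>\<bar> \<le> r / 3" "0 < x" "x \<le> y" "y \<le> \<Lambda> * x" for \<sigma> x y
    proof -
      have "\<bar>T (y + \<sigma>) - T (x + \<sigma>)\<bar> \<le> \<bar>u (y + \<sigma>) - u (x + \<sigma>)\<bar>"
        unfolding T_def by (rule abs_tent_diff_le)
      also have "\<dots> = u (y + \<sigma>) - u (x + \<sigma>)" using r that by (auto simp: u_def max_def)
      also have "\<dots> \<le> 2 * (ln y - ln x)"
        using ln_max_shift_le[of x y r \<sigma>] that r by (simp add: u_def)
      also have "\<dots> \<le> 2 * ln \<Lambda>"
      proof -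
        have "ln y \<le> ln (\<Lambda> * x)" using that by (subst ln_le_cancel_iff) auto
        then show ?thesis using that assms by (simp add: ln_mult)
      qed
      finally have "s * \<bar>T (y + \<sigma>) - T (x + \<sigma>)\<bar> \<le> ln (1 + \<eta>)"
        using s s_lam by (metis mult_left_mono less_imp_le)
      then have "\<bar>s * T (y + \<sigma>) - s * T (x + \<sigma>)\<bar> \<le> ln (1 + \<eta>)"
        using s by (simp add: abs_mult right_diff_distrib[symmetric])
      then have *: "- s * T (y + \<sigma>) \<le> ln (1 + \<eta>) + - s * T (x + \<sigma>)" "- s * T (x + \<sigma>) \<le> ln (1 + \<eta>) + - s * T (y + \<sigma>)"
        by (auto simp: abs_le_iff)
      have **: "exp (ln (1 + \<eta>) + z) = (1 + \<eta>) * exp z" for z using assms by (simp add: exp_add)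
      show ?thesis using *[THEN exp_le_cancel_iff[THEN iffD2]] unfolding V_def ** by blast
    qed
  qed
qed

text \<open>For \<open>b = exp (- x)\<close> the quotient is \<open>exp (x - p * ln n)\<close>, so
  \<open>x\<close> has to be close to an integer multiple of \<open>ln n\<close> for all these
  \<open>n\<close> at once. With \<open>x = q * Q\<close> this is simultaneous approximation of the
  numbers \<open>Q / ln n\<close> with the common denominator \<open>q\<close>.\<close>

lemma exists_point_near_powers:
  fixes \<epsilon> B :: real and N :: nat
  assumes "0 < \<epsilon>" "0 < B"
  obtains b where "0 < b" "b \<le> B"
    "\<And>n. 2 \<le> n \<Longrightarrow> n < N \<Longrightarrow> \<exists>p::int. \<bar>real n powi (- p) / b - 1\<bar> \<le> \<epsilon>"
proof -
  have "((\<lambda>x::real. exp x) \<longlongrightarrow> exp 0) (at 0)" by (intro tendsto_intros)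
  then obtain d where d: "d > 0" "\<And>x::real. \<bar>x\<bar> < d \<Longrightarrow> \<bar>exp x - 1\<bar> < \<epsilon>"
    using assms(1) unfolding LIM_eq by (metis abs_zero diff_0_right diff_self exp_zero real_norm_def)
  \<comment> \<open>Dirichlet's theorem only promises \<open>q > 0\<close>; the factor
    \<open>Q\<close> already forces \<open>x \<ge> - ln B\<close>, that is
    \<open>b \<le> B\<close>.\<close>
  obtain Q :: nat where Q: "real Q \<ge> max 1 (- ln B)" using real_arch_simple by blast
  \<comment> \<open>The error \<open>1 / M\<close> is later multiplied by \<open>ln n\<close>, which
    is at most \<open>ln (N + 1)\<close>, and must stay below \<open>d\<close>.\<close>
  obtain M :: nat where M: "real M > ln (real N + 1) / d" using reals_Archimedean2 by blast
  then have "M > 0" using d by (cases M) (auto simp: divide_less_0_iff not_less)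
  obtain q p where q: "0 < q" and qp: "\<And>i. i < N \<Longrightarrow> \<bar>of_int q * (real Q / ln (real i)) - of_int (p i)\<bar> < 1 / real M"
    using Dirichlet_approx_simult[OF \<open>M > 0\<close>, where \<theta> = "\<lambda>i. real Q / ln (real i)" and n = N] by blast
  define x where "x = of_int q * real Q"
  have "1 * real Q \<le> x" unfolding x_def using q by (intro mult_right_mono) auto
  then have x: "x \<ge> - ln B" using Q by simp
  show ?thesis
  proof
    show "0 < exp (- x)" by simp
    have "exp (- x) \<le> exp (ln B)" using x by (subst exp_le_cancel_iff) simp
    then show "exp (- x) \<le> B" using assms by simp
    show "\<exists>p::int. \<bar>real n powi (- p) / exp (- x) - 1\<bar> \<le> \<epsilon>" if n: "2 \<le> n" "n < N" for n
    proof
      have "real n powi (- p n) = exp (- (of_int (p n) * ln (real n)))"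
        using n by (simp add: powr_real_of_int'[symmetric] powr_def)
      then have "real n powi (- p n) / exp (- x) = exp (x - of_int (p n) * ln (real n))"
        by (simp add: exp_diff exp_minus field_simps)
      moreover have "\<bar>x - of_int (p n) * ln (real n)\<bar> < d"
      proof -
        have l: "ln (real n) > 0" using n by simp
        have "x - of_int (p n) * ln (real n) = (of_int q * (real Q / ln (real n)) - of_int (p n)) * ln (real n)"
          using l by (simp add: x_def field_simps)
        then have "\<bar>x - of_int (p n) * ln (real n)\<bar> = \<bar>of_int q * (real Q / ln (real n)) - of_int (p n)\<bar> * ln (real n)"
          using l by (simp add: abs_mult)
        also have "\<dots> \<le> 1 / real M * ln (real n)"
          using qp[OF n(2)] l by (intro mult_right_mono) auto
        also have "\<dots> \<le> 1 / real M * ln (real N + 1)" using n by (intro mult_left_mono) auto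
        also have "\<dots> < d" using M \<open>M > 0\<close> d by (simp add: field_simps)
        finally show ?thesis .
      qed
      ultimately show "\<bar>real n powi (- p n) / exp (- x) - 1\<bar> \<le> \<epsilon>" using d(2) by (metis less_imp_le)
    qed
  qed
qed

section \<open>Density with dips\<close>

text \<open>The \<open>k\<close>-th dip starts at \<open>b k\<close>, has relative length
  \<open>\<eta> / (2 * N k)\<close> and depth \<open>1 / K k\<close>. The length is chosen so that a
  dip that matters to a child for some \<open>n < N k\<close> is long compared with the whole parent
  interval. The ratio \<open>N k * K k / \<eta>\<close> in the slow variation dominates every ratio
  of distances to a grid point that is compared below. The accuracy \<open>r k / 3\<close> in the
  last assumption is the shift that the profile tolerates.\<close>

locale dips =
  fixes \<eta> :: real and f :: "nat \<Rightarrow> real" and N :: "nat \<Rightarrow> nat"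
    and K r c b :: "nat \<Rightarrow> real" and V :: "nat \<Rightarrow> real \<Rightarrow> real"
  assumes eta: "0 < \<eta>" "\<eta> \<le> 1 / 4"
    and f_ge: "2 \<le> n \<Longrightarrow> 1 + 8 * \<eta> \<le> f n"
    and K_ge: "1 \<le> K k"
    and N_ge: "2 \<le> N k"
    and f_ge_K: "N k \<le> n \<Longrightarrow> K k \<le> f n"
    and r_pos: "0 < r k"
    and r_le_c: "r k \<le> c k"
    and c_le: "c k \<le> \<eta> / (2 * real (N k))"
    and V_measurable [measurable]: "V k \<in> borel_measurable borel"
    and V_ge: "1 / K k \<le> V k t"
    and V_le: "V k t \<le> 1"
    and V_eq_1: "t \<le> r k \<or> \<eta> / (2 * real (N k)) \<le> t \<Longrightarrow> V k t = 1"
    and V_c: "V k (c k) = 1 / K k"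
    and V_slow: "\<bar>\<sigma>\<bar> \<le> r k / 3 \<Longrightarrow> 0 < x \<Longrightarrow> x \<le> y \<Longrightarrow> y \<le> real (N k) * K k / \<eta> * x \<Longrightarrow>
       V k (y + \<sigma>) \<le> (1 + \<eta>) * V k (x + \<sigma>) \<and> V k (x + \<sigma>) \<le> (1 + \<eta>) * V k (y + \<sigma>)"
    and b_pos: "0 < b k"
    and b_0: "b 0 \<le> 1 / 2"
    and b_Suc: "b (Suc k) \<le> \<eta> / 2 * b k"
    and b_grid: "2 \<le> n \<Longrightarrow> n < N k \<Longrightarrow> \<exists>p::int. \<bar>real n powi (- p) / b k - 1\<bar> \<le> r k / 3"
begin

definition \<delta> :: "nat \<Rightarrow> real" where "\<delta> k = \<eta> / (2 * real (N k))"

definition dip :: "nat \<Rightarrow> real set" where "dip k = {b k..<b k + \<delta> k * b k}"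

text \<open>The dips are disjoint, so at most one term of the series is nonzero. Written as a
  series, the density is visibly measurable.\<close>

definition w :: "real \<Rightarrow> real" where
  "w x = 1 - (\<Sum>k. if x \<in> dip k then 1 - V k (x / b k - 1) else 0)"

definition \<nu> :: "real measure" where
  "\<nu> = density (restrict_space lborel {0..<1}) (\<lambda>x. ennreal (w x))"

section \<open>Size and separation of the dips\<close>

lemma delta: "0 < \<delta> k" "\<delta> k * real (N k) = \<eta> / 2" "\<delta> k \<le> 1 / 16" "r k \<le> \<delta> k" "c k \<le> \<delta> k" "\<delta> k \<le> \<eta>"
proof -
  have n: "real (N k) \<ge> 2" using N_ge[of k] by linarith
  show "0 < \<delta> k" "\<delta> k * real (N k) = \<eta> / 2" using n eta by (auto simp: \<delta>_def)
  have "\<delta> k * 2 \<le> \<delta> k * real (N k)" using n \<open>0 < \<delta> k\<close> by (intro mult_left_mono) auto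
  then show "\<delta> k \<le> 1 / 16" "\<delta> k \<le> \<eta>" using \<open>\<delta> k * real (N k) = \<eta> / 2\<close> eta by linarith+
  show "c k \<le> \<delta> k" "r k \<le> \<delta> k" using r_le_c[of k] c_le[of k] by (auto simp: \<delta>_def)
qed

lemma b_less: "i < j \<Longrightarrow> b j \<le> \<eta> / 2 * b i"
proof (induction j)
  case (Suc j)
  have "b (Suc j) \<le> \<eta> / 2 * b j" by (rule b_Suc)
  moreover have "b j \<le> b i"
  proof (cases "i = j")
    case False
    then have "b j \<le> \<eta> / 2 * b i" using Suc by auto
    also have "\<dots> \<le> 1 * b i" using eta b_pos[of i] by (intro mult_right_mono) auto
    finally show ?thesis by simp
  qed simp
  ultimately show ?case using eta by (smt (verit) mult_left_mono divide_nonneg_nonneg)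
qed simp

lemma b_le_half: "b k \<le> 1 / 2"
proof (cases "k = 0")
  case False
  then have "b k \<le> \<eta> / 2 * b 0" using b_less by auto
  also have "\<dots> \<le> 1 * b 0" using eta b_pos[of 0] by (intro mult_right_mono) auto
  finally show ?thesis using b_0 by simp
qed (use b_0 in simp)

text \<open>Points of a dip exceed its left end by less than a factor of 2, which the decay
  \<open>b j \<le> \<eta> / 2 * b i\<close> absorbs.\<close>

lemma dip_separated:
  assumes "i < j" "x \<in> dip i" "y \<in> dip j"
  shows "y < \<eta> * x"
proof -
  have "y < b j * (1 + \<delta> j)" using assms by (simp add: dip_def algebra_simps)
  also have "\<dots> \<le> b j * 2" using delta(3)[of j] b_pos[of j] by (intro mult_left_mono) auto
  also have "\<dots> \<le> \<eta> * b i" using b_less[OF assms(1)] by simp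
  also have "\<dots> \<le> \<eta> * x" using assms eta by (auto simp: dip_def)
  finally show ?thesis .
qed

lemma dip_pos: "x \<in> dip k \<Longrightarrow> 0 < x"
  using b_pos[of k] by (auto simp: dip_def)

lemma dip_unique:
  assumes "x \<in> dip i" "x \<in> dip j"
  shows "i = j"
proof -
  have "\<eta> * x \<le> 1 * x" using dip_pos[OF assms(1)] eta by (intro mult_right_mono) auto
  then have "\<not> x < \<eta> * x" by simp
  then show ?thesis using dip_separated[of i j x x] dip_separated[of j i x x] assms by (metis nat_neq_iff)
qed

lemma w_dip: "x \<in> dip k \<Longrightarrow> w x = V k (x / b k - 1)"
proof -
  assume x: "x \<in> dip k"
  have "(\<Sum>j. if x \<in> dip j then 1 - V j (x / b j - 1) else 0) = (\<Sum>j\<in>{k}. if x \<in> dip j then 1 - V j (x / b j - 1) else 0)"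
    by (rule suminf_finite) (use dip_unique[OF x] in auto)
  then show ?thesis using x by (simp add: w_def)
qed

lemma w_out: "(\<And>k. x \<notin> dip k) \<Longrightarrow> w x = 1"
  by (simp add: w_def)

lemma w_bounds: "0 < w x" "w x \<le> 1"
proof -
  have "0 < w x \<and> w x \<le> 1"
  proof (cases "\<exists>k. x \<in> dip k")
    case True
    then obtain k where k: "x \<in> dip k" by blast
    have "0 < 1 / K k" using K_ge[of k] by simp
    then have "0 < V k (x / b k - 1)" using V_ge[of k "x / b k - 1"] by linarith
    then show ?thesis using w_dip[OF k] V_le by simp
  qed (use w_out in auto)
  then show "0 < w x" "w x \<le> 1" by auto
qed

lemma w_measurable [measurable]: "w \<in> borel_measurable borel"
  unfolding w_def dip_def by measurable

text \<open>Points of distinct dips differ by more than the factor \<open>1 / \<eta>\<close>, hence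
  an interval whose end points have at most this ratio meets at most one dip. The formula with
  \<open>V k\<close> extends to the whole interval because the profile is 1 off its dip.\<close>

lemma one_dip_cases:
  assumes "0 < x" "\<eta> * y \<le> x"
  obtains (none) "\<And>z. z \<in> {x..<y} \<Longrightarrow> w z = 1"
    | (one) k where "{x..<y} \<inter> dip k \<noteq> {}" "\<And>z. z \<in> {x..<y} \<Longrightarrow> w z = V k (z / b k - 1)"
        "\<And>z. z \<in> {x..<y} \<Longrightarrow> z \<notin> dip k \<Longrightarrow> w z = 1"
proof (cases "\<exists>k. {x..<y} \<inter> dip k \<noteq> {}")
  case False
  then show ?thesis by (intro none w_out) blast
next
  case True
  then obtain k z where z: "z \<in> {x..<y}" "z \<in> dip k" by blast
  have other: "u \<notin> dip j" if u: "u \<in> {x..<y}" and "j \<noteq> k" for u j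
  proof
    assume uj: "u \<in> dip j"
    have "\<not> u < \<eta> * z" "\<not> z < \<eta> * u"
      using u z(1) eta assms mult_left_mono[of z y \<eta>] mult_left_mono[of u y \<eta>]
      unfolding atLeastLessThan_iff by linarith+
    then show False using dip_separated uj z \<open>j \<noteq> k\<close> by (metis nat_neq_iff)
  qed
  show ?thesis
  proof (rule one)
    show "{x..<y} \<inter> dip k \<noteq> {}" using z by blast
    show 1: "w u = 1" if "u \<in> {x..<y}" "u \<notin> dip k" for u
      using that other by (intro w_out) metis
    show "w u = V k (u / b k - 1)" if u: "u \<in> {x..<y}" for u
    proof (cases "u \<in> dip k")
      case False
      then have "u / b k < 1 \<or> 1 + \<delta> k \<le> u / b k"
        using b_pos[of k] by (auto simp: dip_def field_simps)
      then have "u / b k - 1 \<le> r k \<or> \<delta> k \<le> u / b k - 1"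
        using r_pos[of k] by linarith
      then show ?thesis using 1[OF u False] V_eq_1[of "u / b k - 1" k] by (simp add: \<delta>_def)
    qed (rule w_dip)
  qed
qed

section \<open>Mass of intervals\<close>

lemma emeasure_nu:
  assumes "0 \<le> x" "y \<le> 1"
  shows "emeasure \<nu> {x..<y} = (\<integral>\<^sup>+ z. ennreal (w z) * indicator {x..<y} z \<partial>lborel)"
proof -
  have sub: "{x..<y} \<subseteq> {0..<1}" using assms by auto
  have m: "{x..<y} \<in> sets (restrict_space lborel {0..<1})"
    using sub by (auto simp: sets_restrict_space image_iff intro!: bexI[of _ "{x..<y}"])
  have "w \<in> borel_measurable (restrict_space lborel {0..<1})"
    by (intro measurable_restrict_space1) simp
  then have "emeasure \<nu> {x..<y} = (\<integral>\<^sup>+ z. ennreal (w z) * indicator {x..<y} z * indicator {0..<1} z \<partial>lborel)"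
    unfolding \<nu>_def using m
    by (subst emeasure_density) (auto simp: nn_integral_restrict_space)
  also have "\<dots> = (\<integral>\<^sup>+ z. ennreal (w z) * indicator {x..<y} z \<partial>lborel)"
    using sub by (intro nn_integral_cong) (auto simp: indicator_def)
  finally show ?thesis .
qed

definition mass :: "real \<Rightarrow> real \<Rightarrow> real" where "mass x y = measure \<nu> {x..<y}"

lemma emeasure_nu_finite: "0 \<le> x \<Longrightarrow> y \<le> 1 \<Longrightarrow> emeasure \<nu> {x..<y} < \<infinity>"
proof -
  assume xy: "0 \<le> x" "y \<le> 1"
  have "emeasure \<nu> {x..<y} \<le> (\<integral>\<^sup>+ z. indicator {x..<y} z \<partial>lborel)"
    unfolding emeasure_nu[OF xy] using w_bounds
    by (intro nn_integral_mono) (auto simp: indicator_def)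
  also have "\<dots> < \<infinity>" by (cases "x \<le> y") auto
  finally show ?thesis .
qed

lemma emeasure_mass: "0 \<le> x \<Longrightarrow> y \<le> 1 \<Longrightarrow> emeasure \<nu> {x..<y} = ennreal (mass x y)"
  unfolding mass_def using emeasure_nu_finite by (intro emeasure_eq_ennreal_measure) (auto simp: less_top)

lemma mass_nonneg: "0 \<le> mass x y" by (simp add: mass_def)

lemma mass_upper:
  assumes "0 \<le> x" "x \<le> y" "y \<le> 1" "\<And>z. z \<in> {x..<y} \<Longrightarrow> w z \<le> h" "0 \<le> h"
  shows "mass x y \<le> h * (y - x)"
proof -
  have "emeasure \<nu> {x..<y} \<le> (\<integral>\<^sup>+ z. ennreal h * indicator {x..<y} z \<partial>lborel)"
    unfolding emeasure_nu[OF assms(1,3)] using assms(4)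
    by (intro nn_integral_mono) (auto simp: indicator_def intro: ennreal_leI)
  also have "\<dots> = ennreal (h * (y - x))"
    using assms by (simp add: nn_integral_cmult_indicator ennreal_mult)
  finally show ?thesis using assms by (simp add: emeasure_mass)
qed

lemma mass_lower:
  assumes "0 \<le> x" "x \<le> y" "y \<le> 1" "\<And>z. z \<in> {x..<y} \<Longrightarrow> h \<le> w z" "0 \<le> h"
  shows "h * (y - x) \<le> mass x y"
proof -
  have "ennreal (h * (y - x)) = (\<integral>\<^sup>+ z. ennreal h * indicator {x..<y} z \<partial>lborel)"
    using assms by (simp add: nn_integral_cmult_indicator ennreal_mult)
  also have "\<dots> \<le> emeasure \<nu> {x..<y}"
    unfolding emeasure_nu[OF assms(1,3)] using assms(4)
    by (intro nn_integral_mono) (auto simp: indicator_def intro: ennreal_leI)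
  finally show ?thesis using assms mass_nonneg by (simp add: emeasure_mass)
qed

lemma sets_nu: "sets \<nu> = sets (restrict_space borel {0..<1})"
  by (simp add: \<nu>_def sets_restrict_space)

lemma mass_split:
  assumes "0 \<le> x" "x \<le> y" "y \<le> z" "z \<le> 1"
  shows "mass x z = mass x y + mass y z"
proof -
  have m: "{u..<v} \<in> sets \<nu>" if "0 \<le> u" "v \<le> 1" for u v
    using that unfolding sets_nu by (auto simp: sets_restrict_space image_iff intro!: bexI[of _ "{u..<v}"])
  have "emeasure \<nu> {x..<z} = emeasure \<nu> {x..<y} + emeasure \<nu> {y..<z}"
    using assms m by (subst plus_emeasure) (auto simp: ivl_disj_un)
  then have "ennreal (mass x z) = ennreal (mass x y + mass y z)"
    using assms mass_nonneg by (subst ennreal_plus) (auto simp: emeasure_mass)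
  then show ?thesis using mass_nonneg by (subst (asm) ennreal_inj) (auto intro: add_nonneg_nonneg)
qed

lemma mass_le: "0 \<le> x \<Longrightarrow> x \<le> y \<Longrightarrow> y \<le> 1 \<Longrightarrow> mass x y \<le> y - x"
  using mass_upper[of x y 1] w_bounds by simp

lemma mass_lower_dip:
  assumes "0 \<le> x" "x \<le> y" "y \<le> 1" "\<And>z. z \<in> {x..<y} \<Longrightarrow> z \<notin> dip k \<Longrightarrow> w z = 1"
  shows "(y - x) - \<delta> k * b k \<le> mass x y"
proof -
  \<comment> \<open>The part of the dip inside \<open>[x, y)\<close> is \<open>[p, q)\<close>; the
    clamping makes it empty if the dip lies outside.\<close>
  define p where "p = max x (min y (b k))"
  define q where "q = max x (min y (b k + \<delta> k * b k))"
  have d: "0 < \<delta> k * b k" using delta b_pos by simp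
  have pq: "x \<le> p" "p \<le> q" "q \<le> y" "q - p \<le> \<delta> k * b k"
    using assms d by (auto simp: p_def q_def)
  have "1 \<le> w z" if "z \<in> {x..<p} \<union> {q..<y}" for z
  proof -
    have "z \<in> {x..<y}" "z \<notin> dip k" using that pq by (auto simp: p_def q_def dip_def)
    then show ?thesis using assms(4) by simp
  qed
  note w = this
  have "1 * (p - x) \<le> mass x p"
    using pq assms w by (intro mass_lower) auto
  moreover have "1 * (y - q) \<le> mass q y"
    using pq assms w by (intro mass_lower) auto
  moreover have "mass x y = mass x p + (mass p q + mass q y)"
    using pq assms by (simp add: mass_split[of x p y] mass_split[of p q y])
  ultimately show ?thesis using mass_nonneg[of p q] pq(4) by simp
qed

subsection \<open>Comparing the children of an interval\<close>

text \<open>The margin \<open>8 * \<eta>\<close> by which \<open>f n\<close> exceeds 1 compensates a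
  relative loss of \<open>2 * \<eta>\<close>, because \<open>\<eta> \<le> 1 / 4\<close>.\<close>

lemma le_f_mult:
  assumes "2 \<le> n" "(1 - 2 * \<eta>) * l \<le> M" "0 \<le> l"
  shows "l \<le> f n * M"
proof -
  have "1 \<le> (1 + 8 * \<eta>) * (1 - 2 * \<eta>)"
    using eta mult_left_mono[of "\<eta>" "1/4" "\<eta>"] by (simp add: algebra_simps)
  then have "1 * l \<le> ((1 + 8 * \<eta>) * (1 - 2 * \<eta>)) * l" using assms(3) by (rule mult_right_mono)
  also have "\<dots> = (1 + 8 * \<eta>) * ((1 - 2 * \<eta>) * l)" by simp
  also have "\<dots> \<le> f n * M"
    using assms eta f_ge[of n] by (intro mult_mono) auto
  finally show ?thesis by simp
qed

text \<open>For \<open>n \<ge> N k\<close> the allowed factor \<open>f n\<close> is at least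
  \<open>K k\<close>, so even the lowest density \<open>1 / K k\<close> is high enough.\<close>

lemma mass_crude:
  assumes "N k \<le> n" "0 \<le> x" "x \<le> y" "y \<le> 1" "\<And>z. z \<in> {x..<y} \<Longrightarrow> w z = V k (z / b k - 1)"
  shows "y - x \<le> f n * mass x y"
proof -
  have "1 / K k * (y - x) \<le> mass x y"
    using assms V_ge K_ge[of k] by (intro mass_lower) auto
  then have "y - x \<le> K k * mass x y" using K_ge[of k] by (simp add: field_simps)
  also have "\<dots> \<le> f n * mass x y" using f_ge_K[OF assms(1)] mass_nonneg by (intro mult_right_mono)
  finally show ?thesis .
qed

lemma mass_dip_negligible:
  assumes "2 \<le> n" "0 \<le> x" "x \<le> y" "y \<le> 1" "\<delta> k * b k \<le> \<eta> * (y - x)"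
    "\<And>z. z \<in> {x..<y} \<Longrightarrow> z \<notin> dip k \<Longrightarrow> w z = 1"
  shows "y - x \<le> f n * mass x y"
proof (rule le_f_mult[OF assms(1)])
  have "(y - x) - \<delta> k * b k \<le> mass x y" using assms by (intro mass_lower_dip) auto
  moreover have "0 \<le> \<eta> * (y - x)" using eta assms by simp
  ultimately show "(1 - 2 * \<eta>) * (y - x) \<le> mass x y" using assms by (simp add: algebra_simps)
qed (use assms in simp)

lemma mass_no_dip:
  assumes "2 \<le> n" "0 \<le> x" "x \<le> y" "y \<le> 1" "\<And>z. z \<in> {x..<y} \<Longrightarrow> w z = 1"
  shows "y - x \<le> f n * mass x y"
proof -
  have "1 * (y - x) \<le> mass x y" using assms by (intro mass_lower) auto
  moreover have "1 * mass x y \<le> f n * mass x y"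
    using f_ge[OF assms(1)] eta mass_nonneg by (intro mult_right_mono) auto
  ultimately show ?thesis by simp
qed

text \<open>A parent starting at 0 meets infinitely many dips, but all that concern
  \<open>n < N k\<close> are short compared with a child: \<open>b k \<le> n * l\<close> makes the
  length of the dip at most \<open>\<eta> / 2 * l\<close>. The first child is treated separately,
  since there the end points have no bounded ratio.\<close>

lemma mass_initial_child:
  assumes n: "2 \<le> n" and l: "0 < l" "real n * l \<le> 1" and i: "i < n"
  shows "l \<le> f n * mass (real i * l) (real (Suc i) * l)"
proof (cases "i = 0")
  case True
  have "1 * l \<le> real n * l" using n l by (intro mult_right_mono) auto
  then have l1: "l \<le> 1" using l by linarith
  have el: "0 < \<eta> * l" "\<eta> * l \<le> l" using eta l by auto
  \<comment> \<open>Dropping \<open>[0, \<eta> * l)\<close> loses at most the share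
    \<open>\<eta>\<close> and leaves at most one dip, whose length is again at most
    \<open>\<eta> * l\<close>.\<close>
  have "(1 - 2 * \<eta>) * l \<le> mass (\<eta> * l) l"
  proof (rule one_dip_cases[of "\<eta> * l" l])
    assume "\<And>z. z \<in> {\<eta> * l..<l} \<Longrightarrow> w z = 1"
    then have "1 * (l - \<eta> * l) \<le> mass (\<eta> * l) l" using el l1 by (intro mass_lower) auto
    then show ?thesis using el by (simp add: algebra_simps)
  next
    fix k assume k: "{\<eta> * l..<l} \<inter> dip k \<noteq> {}" "\<And>z. z \<in> {\<eta> * l..<l} \<Longrightarrow> z \<notin> dip k \<Longrightarrow> w z = 1"
    have "(l - \<eta> * l) - \<delta> k * b k \<le> mass (\<eta> * l) l"
      using el l1 k by (intro mass_lower_dip) auto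
    moreover have "\<delta> k * b k \<le> \<eta> * l"
    proof (rule mult_mono)
      show "\<delta> k \<le> \<eta>" using delta(6) .
      show "b k \<le> l" using k by (auto simp: dip_def)
    qed (use eta b_pos[of k] in auto)
    ultimately show ?thesis by (simp add: algebra_simps)
  qed (use el in auto)
  also have "\<dots> \<le> mass 0 l"
    using mass_split[of 0 "\<eta> * l" l] mass_nonneg[of 0 "\<eta> * l"] el l1 by simp
  finally show ?thesis using le_f_mult[OF n, of l] True l by simp
next
  case False
  define x where "x = real i * l"
  define y where "y = real (Suc i) * l"
  have i1: "real i \<ge> 1" using False by simp
  have xy: "y - x = l" by (simp add: x_def y_def algebra_simps)
  have x0: "0 < x" using i1 l by (simp add: x_def)
  have lx: "l \<le> x" using mult_right_mono[OF i1, of l] l by (simp add: x_def)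
  have yn: "y \<le> real n * l" unfolding y_def using i l by (intro mult_right_mono) auto
  have y1: "y \<le> 1" using yn l by simp
  have "\<eta> * y \<le> 1 / 2 * y" using eta x0 xy l by (intro mult_right_mono) auto
  then have ey: "\<eta> * y \<le> x" using lx xy by linarith
  have "y - x \<le> f n * mass x y"
  proof (rule one_dip_cases[OF x0 ey])
    assume "\<And>z. z \<in> {x..<y} \<Longrightarrow> w z = 1"
    then show ?thesis using n x0 xy l y1 by (intro mass_no_dip) auto
  next
    fix k assume k: "{x..<y} \<inter> dip k \<noteq> {}" "\<And>z. z \<in> {x..<y} \<Longrightarrow> w z = V k (z / b k - 1)"
      "\<And>z. z \<in> {x..<y} \<Longrightarrow> z \<notin> dip k \<Longrightarrow> w z = 1"
    show ?thesis
    proof (cases "N k \<le> n")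
      case True
      then show ?thesis using k x0 xy l y1 by (intro mass_crude) auto
    next
      case False
      have "b k \<le> real n * l" using k(1) yn by (auto simp: dip_def)
      also have "\<dots> \<le> real (N k) * l" using False l by (intro mult_right_mono) auto
      finally have "\<delta> k * b k \<le> \<delta> k * (real (N k) * l)" using delta(1)[of k] by (intro mult_left_mono) auto
      also have "\<dots> = \<eta> / 2 * l" using delta(2)[of k] by simp
      also have "\<dots> \<le> \<eta> * (y - x)" using eta l xy by simp
      finally show ?thesis using n x0 xy l y1 k by (intro mass_dip_negligible[of n x y k]) auto
    qed
  qed
  then show ?thesis by (simp only: xy x_def[symmetric] y_def[symmetric])
qed

section \<open>Parents close to a dip\<close>

lemma V_slow_shifted:
  assumes "\<bar>\<beta> / b k - 1\<bar> \<le> r k / 3" "0 < s" "s \<le> t" "t \<le> real (N k) * K k / \<eta> * s"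
  shows "V k ((\<beta> + t) / b k - 1) \<le> (1 + \<eta>) * V k ((\<beta> + s) / b k - 1)"
    and "V k ((\<beta> + s) / b k - 1) \<le> (1 + \<eta>) * V k ((\<beta> + t) / b k - 1)"
proof -
  have *: "u / b k + (\<beta> / b k - 1) = (\<beta> + u) / b k - 1" for u by (simp add: add_divide_distrib)
  have "0 < s / b k" "s / b k \<le> t / b k" "t / b k \<le> real (N k) * K k / \<eta> * (s / b k)"
    using assms b_pos[of k] divide_right_mono[OF assms(4), of "b k"] by (auto simp: divide_right_mono)
  \<comment> \<open>The shift is \<open>\<sigma> = \<beta> / b k - 1\<close>: distances are measured
    from the grid point \<open>\<beta>\<close> instead of \<open>b k\<close>.\<close>
  from V_slow[OF assms(1) this]
  show "V k ((\<beta> + t) / b k - 1) \<le> (1 + \<eta>) * V k ((\<beta> + s) / b k - 1)"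
    "V k ((\<beta> + s) / b k - 1) \<le> (1 + \<eta>) * V k ((\<beta> + t) / b k - 1)"
    unfolding * by auto
qed

text \<open>The three ratios of distances to \<open>\<beta>\<close> that occur: 2 inside a parent at
  least its own length away from \<open>\<beta>\<close>, \<open>K k / \<eta>\<close> inside a child
  starting at \<open>\<beta>\<close> after removal of a short initial piece, and \<open>N k\<close>
  between the children of a parent starting at \<open>\<beta>\<close>.\<close>

lemma Lambda_ge: "2 \<le> real (N k) * K k / \<eta>" "K k / \<eta> \<le> real (N k) * K k / \<eta>" "real (N k) \<le> real (N k) * K k / \<eta>"
proof -
  have n: "real (N k) \<ge> 2" using N_ge[of k] by linarith
  have "1 * 1 \<le> K k / \<eta>" using K_ge[of k] eta by (simp add: field_simps)
  then have "real (N k) * 1 \<le> real (N k) * (K k / \<eta>)" by (intro mult_left_mono) auto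
  then show "real (N k) \<le> real (N k) * K k / \<eta>" by simp
  then show "2 \<le> real (N k) * K k / \<eta>" using n by linarith
  have "1 * (K k / \<eta>) \<le> real (N k) * (K k / \<eta>)" using n K_ge[of k] eta by (intro mult_right_mono) auto
  then show "K k / \<eta> \<le> real (N k) * K k / \<eta>" by simp
qed

lemma V_pos: "0 < V k t"
  using V_ge[of k t] K_ge[of k] by (smt (verit) divide_pos_pos)

text \<open>Serves the first child of a parent that starts at the grid point \<open>\<beta>\<close>,
  where distances to \<open>\<beta>\<close> have unbounded ratio. With \<open>\<beta> = b k\<close>
  it also bounds the mass to the right of \<open>b k\<close> in the failure of doubling.\<close>

lemma mass_near_dip:
  assumes \<beta>: "\<bar>\<beta> / b k - 1\<bar> \<le> r k / 3" "0 \<le> \<beta>" and x: "0 < x" "\<beta> + x \<le> 1"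
    and w: "\<And>z. z \<in> {\<beta>..<\<beta> + x} \<Longrightarrow> w z = V k (z / b k - 1)"
  defines "W \<equiv> V k ((\<beta> + x) / b k - 1)"
  shows "mass \<beta> (\<beta> + x) \<le> (1 + 2 * \<eta>) * W * x"
    and "(1 - \<eta>) / (1 + \<eta>) * W * x \<le> mass \<beta> (\<beta> + x)"
proof -
  \<comment> \<open>On \<open>[\<beta>, \<beta> + \<theta> x)\<close> the density may be \<open>K k\<close> times as large as \<open>W\<close>, but this part is too short to matter.\<close>
  define \<theta> where "\<theta> = \<eta> / K k"
  have th: "0 < \<theta>" "\<theta> \<le> \<eta>" using eta K_ge[of k] by (auto simp: \<theta>_def divide_le_eq mult_le_cancel_left1)
  have tx: "0 < \<theta> * x" "\<theta> * x \<le> x" using th eta x by (auto simp: mult_le_cancel_right1)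
  have W: "0 < W" "1 / K k \<le> W" using V_pos V_ge by (auto simp: W_def)
  have slow: "w z \<le> (1 + \<eta>) * W" "W / (1 + \<eta>) \<le> w z" if z: "z \<in> {\<beta> + \<theta> * x..<\<beta> + x}" for z
  proof -
    have z': "0 < z - \<beta>" "z - \<beta> \<le> x" "\<theta> * x \<le> z - \<beta>" using z tx by auto
    have "x = K k / \<eta> * (\<theta> * x)" using eta K_ge[of k] by (simp add: \<theta>_def)
    also have "\<dots> \<le> K k / \<eta> * (z - \<beta>)" using z' eta K_ge[of k] by (intro mult_left_mono) auto
    also have "\<dots> \<le> real (N k) * K k / \<eta> * (z - \<beta>)" using z' Lambda_ge(2)[of k] by (intro mult_right_mono) auto
    finally have "w z \<le> (1 + \<eta>) * W \<and> W \<le> (1 + \<eta>) * w z"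
      using V_slow_shifted[OF \<beta>(1) z'(1,2)] w[of z] z tx by (simp add: W_def)
    then show "w z \<le> (1 + \<eta>) * W" "W / (1 + \<eta>) \<le> w z" using eta by (auto simp: field_simps)
  qed
  have split: "mass \<beta> (\<beta> + x) = mass \<beta> (\<beta> + \<theta> * x) + mass (\<beta> + \<theta> * x) (\<beta> + x)"
    using \<beta> tx x by (intro mass_split) auto
  have "mass \<beta> (\<beta> + \<theta> * x) \<le> \<theta> * x"
    using mass_le[of \<beta> "\<beta> + \<theta> * x"] \<beta> tx x by simp
  also have "\<dots> = \<eta> * (1 / K k) * x" by (simp add: \<theta>_def)
  also have "\<dots> \<le> \<eta> * W * x" using W eta x by (intro mult_right_mono mult_left_mono) auto
  finally have 1: "mass \<beta> (\<beta> + \<theta> * x) \<le> \<eta> * W * x" .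
  have "mass (\<beta> + \<theta> * x) (\<beta> + x) \<le> (1 + \<eta>) * W * ((\<beta> + x) - (\<beta> + \<theta> * x))"
    using slow \<beta> tx x W eta by (intro mass_upper) auto
  also have "\<dots> \<le> (1 + \<eta>) * W * x" using W eta tx by (intro mult_left_mono) auto
  finally show "mass \<beta> (\<beta> + x) \<le> (1 + 2 * \<eta>) * W * x" using 1 split by (simp add: algebra_simps)
  have "(1 - \<eta>) * x \<le> (\<beta> + x) - (\<beta> + \<theta> * x)" using th x by (simp add: algebra_simps)
  then have "W / (1 + \<eta>) * ((1 - \<eta>) * x) \<le> W / (1 + \<eta>) * ((\<beta> + x) - (\<beta> + \<theta> * x))"
    using W eta by (intro mult_left_mono) auto
  also have "\<dots> \<le> mass (\<beta> + \<theta> * x) (\<beta> + x)"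
    using slow \<beta> tx x W eta by (intro mass_lower) auto
  also have "\<dots> \<le> mass \<beta> (\<beta> + x)" using split mass_nonneg[of \<beta> "\<beta> + \<theta> * x"] by simp
  finally show "(1 - \<eta>) / (1 + \<eta>) * W * x \<le> mass \<beta> (\<beta> + x)" by (simp add: algebra_simps)
qed

text \<open>A lower bound \<open>A * l\<close> common to all children, exceeded by at most the
  factor \<open>f n\<close>, makes any two of them comparable. It comes from slow variation, as the
  distances to \<open>\<beta>\<close> have bounded ratio on the parent, except in a first child that
  starts at \<open>\<beta>\<close>.\<close>

lemma comparable_near_dip:
  assumes n: "2 \<le> n" "n < N k" and l: "0 < l" and \<beta>: "\<bar>\<beta> / b k - 1\<bar> \<le> r k / 3" "0 \<le> \<beta>"
    and a: "a = \<beta> \<or> real n * l \<le> a - \<beta>" "a + real n * l \<le> 1"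
    and w: "\<And>z. z \<in> {a..<a + real n * l} \<Longrightarrow> w z = V k (z / b k - 1)"
  shows "\<exists>A>0. \<forall>i<n. A * l \<le> mass (a + real i * l) (a + real (Suc i) * l) \<and>
    mass (a + real i * l) (a + real (Suc i) * l) \<le> f n * A * l"
proof -
  have f1: "1 + 8 * \<eta> \<le> f n" using f_ge n by simp
  have child: "a \<le> a + real i * l" "a + real i * l \<le> a + real (Suc i) * l" "a + real (Suc i) * l \<le> a + real n * l"
    "a + real (Suc i) * l - (a + real i * l) = l" if "i < n" for i
  proof -
    have "real (Suc i) * l \<le> real n * l" using that l by (intro mult_right_mono) auto
    then show "a + real (Suc i) * l \<le> a + real n * l" by simp
  qed (use l in \<open>auto simp: algebra_simps\<close>)
  have sub: "{a + real i * l..<a + real (Suc i) * l} \<subseteq> {a..<a + real n * l}" if "i < n" for i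
    using child[OF that] by (meson atLeastLessThan_iff order_trans less_le_trans subsetI)
  from a(1) show ?thesis
  proof
    assume L: "real n * l \<le> a - \<beta>"
    have nl: "0 < real n * l" using n l by simp
    \<comment> \<open>The density is compared with its formula at the left end \<open>a\<close>. The
      parent is no longer than \<open>a - \<beta>\<close>, so distances to \<open>\<beta>\<close> at
      most double.\<close>
    define W where "W = V k ((\<beta> + (a - \<beta>)) / b k - 1)"
    have W: "0 < W" using V_pos by (simp add: W_def)
    have slow: "w z \<le> (1 + \<eta>) * W" "W / (1 + \<eta>) \<le> w z" if z: "z \<in> {a..<a + real n * l}" for z
    proof -
      have "z - \<beta> \<le> 2 * (a - \<beta>)" using z L by auto
      also have "\<dots> \<le> real (N k) * K k / \<eta> * (a - \<beta>)" using Lambda_ge(1)[of k] L nl by (intro mult_right_mono) auto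
      finally have "w z \<le> (1 + \<eta>) * W \<and> W \<le> (1 + \<eta>) * w z"
        using V_slow_shifted[OF \<beta>(1), of "a - \<beta>" "z - \<beta>"] L nl w[OF z] z by (simp add: W_def)
      then show "w z \<le> (1 + \<eta>) * W" "W / (1 + \<eta>) \<le> w z" using eta by (auto simp: field_simps)
    qed
    have fA: "(1 + \<eta>) * W \<le> f n * (W / (1 + \<eta>))"
    proof -
      have "(1 + \<eta>) * (1 + \<eta>) \<le> 1 + 8 * \<eta>" using eta mult_left_mono[of \<eta> "1/4" \<eta>] by (simp add: algebra_simps)
      then have "(1 + \<eta>) * (1 + \<eta>) * W \<le> f n * W" using f1 W by (intro mult_right_mono) auto
      then show ?thesis using eta by (simp add: field_simps)
    qed
    show ?thesis
    proof (intro exI[of _ "W / (1 + \<eta>)"] conjI allI impI)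
      show "0 < W / (1 + \<eta>)" using W eta by simp
      fix i assume i: "i < n"
      have "W / (1 + \<eta>) * (a + real (Suc i) * l - (a + real i * l)) \<le> mass (a + real i * l) (a + real (Suc i) * l)"
        using child[OF i] a L nl \<beta> W eta by (intro mass_lower slow(2)[OF subsetD[OF sub[OF i]]]) auto
      then show "W / (1 + \<eta>) * l \<le> mass (a + real i * l) (a + real (Suc i) * l)" unfolding child(4)[OF i] .
      have "mass (a + real i * l) (a + real (Suc i) * l) \<le> (1 + \<eta>) * W * (a + real (Suc i) * l - (a + real i * l))"
        using child[OF i] a L nl \<beta> W eta by (intro mass_upper slow(1)[OF subsetD[OF sub[OF i]]]) auto
      also have "\<dots> \<le> f n * (W / (1 + \<eta>)) * l" unfolding child(4)[OF i] using fA l by (intro mult_right_mono) auto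
      finally show "mass (a + real i * l) (a + real (Suc i) * l) \<le> f n * (W / (1 + \<eta>)) * l" .
    qed
  next
    assume a\<beta>: "a = \<beta>"
    \<comment> \<open>Reference value at the right end of the first child, at distance
      \<open>l\<close> from \<open>\<beta>\<close>. In the other children the distances range from
      \<open>l\<close> to \<open>n * l\<close>.\<close>
    define W where "W = V k ((\<beta> + l) / b k - 1)"
    have W: "0 < W" using V_pos by (simp add: W_def)
    define A where "A = (1 - \<eta>) / (1 + \<eta>) * W"
    have A: "0 < A" using W eta by (simp add: A_def)
    have WA: "A \<le> W / (1 + \<eta>)" using W eta by (simp add: A_def divide_right_mono mult_le_cancel_right1)
    have fA: "(1 + 2 * \<eta>) * W \<le> f n * A"
    proof -
      \<comment> \<open>Both constants of \<open>mass_near_dip\<close> have to fit into the margin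
        \<open>8 * \<eta>\<close> of \<open>f n\<close>.\<close>
      have "(1 + 2 * \<eta>) * (1 + \<eta>) \<le> (1 + 8 * \<eta>) * (1 - \<eta>)"
        using eta mult_left_mono[of \<eta> "1/4" \<eta>] by (simp add: algebra_simps)
      also have "\<dots> \<le> f n * (1 - \<eta>)" using f1 eta by (intro mult_right_mono) auto
      finally have "(1 + 2 * \<eta>) * (1 + \<eta>) * W \<le> f n * (1 - \<eta>) * W" using W by (intro mult_right_mono) auto
      then show ?thesis using eta by (simp add: A_def field_simps)
    qed
    show ?thesis
    proof (intro exI[of _ A] conjI allI impI)
      show "0 < A" by (rule A)
      fix i assume i: "i < n"
      have "A * l \<le> mass (a + real i * l) (a + real (Suc i) * l) \<and> mass (a + real i * l) (a + real (Suc i) * l) \<le> (1 + 2 * \<eta>) * W * l"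
      proof (cases "i = 0")
        case True
        have "1 * l \<le> real n * l" using n l by (intro mult_right_mono) auto
        then have "l \<le> real n * l" by linarith
        then have "{\<beta>..<\<beta> + l} \<subseteq> {a..<a + real n * l}" "\<beta> + l \<le> 1"
          using a(2) unfolding a\<beta> subset_iff atLeastLessThan_iff by linarith+
        then have "\<And>z. z \<in> {\<beta>..<\<beta> + l} \<Longrightarrow> w z = V k (z / b k - 1)" "\<beta> + l \<le> 1"
          using w by blast+
        from mass_near_dip[OF \<beta> l this(2,1)] show ?thesis using True a\<beta> by (simp add: A_def W_def)
      next
        case False
        have slow: "w z \<le> (1 + \<eta>) * W" "W / (1 + \<eta>) \<le> w z" if z: "z \<in> {a + real i * l..<a + real (Suc i) * l}" for z
        proof -
          have "1 * l \<le> real i * l" using False l by (intro mult_right_mono) auto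
          then have z': "l \<le> z - \<beta>" "z - \<beta> \<le> real n * l" "z \<in> {a..<a + real n * l}"
            using z child(3)[OF i] l unfolding a\<beta> atLeastLessThan_iff by linarith+
          have "real n * l \<le> real (N k) * l" using n l by (intro mult_right_mono) auto
          also have "\<dots> \<le> real (N k) * K k / \<eta> * l" using Lambda_ge(3)[of k] l by (intro mult_right_mono) auto
          finally have "w z \<le> (1 + \<eta>) * W \<and> W \<le> (1 + \<eta>) * w z"
            using V_slow_shifted[OF \<beta>(1) l z'(1)] w[OF z'(3)] z'(2) by (simp add: W_def)
          then show "w z \<le> (1 + \<eta>) * W" "W / (1 + \<eta>) \<le> w z" using eta by (auto simp: field_simps)
        qed
        have "W / (1 + \<eta>) * (a + real (Suc i) * l - (a + real i * l)) \<le> mass (a + real i * l) (a + real (Suc i) * l)"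
          using child[OF i] slow(2) a a\<beta> \<beta> W eta by (intro mass_lower) auto
        then have 1: "W / (1 + \<eta>) * l \<le> mass (a + real i * l) (a + real (Suc i) * l)" unfolding child(4)[OF i] .
        have "mass (a + real i * l) (a + real (Suc i) * l) \<le> (1 + \<eta>) * W * (a + real (Suc i) * l - (a + real i * l))"
          using child[OF i] slow(1) a a\<beta> \<beta> W eta by (intro mass_upper) auto
        also have "\<dots> \<le> (1 + 2 * \<eta>) * W * l" unfolding child(4)[OF i] using W eta l by (intro mult_right_mono) auto
        finally show ?thesis using 1 mult_right_mono[OF WA, of l] l by simp
      qed
      moreover have "(1 + 2 * \<eta>) * W * l \<le> f n * A * l" using fA l by (intro mult_right_mono) auto
      ultimately show "A * l \<le> mass (a + real i * l) (a + real (Suc i) * l)" "mass (a + real i * l) (a + real (Suc i) * l) \<le> f n * A * l"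
        by auto
    qed
  qed
qed

text \<open>The density is at most 1, so no child has mass above \<open>l\<close>, and lower bounds
  alone suffice: \<open>A = 1 / f n\<close>.\<close>

lemma children_comparable_no_dip:
  assumes n: "2 \<le> n" and l: "0 < l" and a: "0 \<le> a" "a + real n * l \<le> 1"
    and M: "\<And>i. i < n \<Longrightarrow> l \<le> f n * mass (a + real i * l) (a + real (Suc i) * l)"
  shows "\<exists>A>0. \<forall>i<n. A * l \<le> mass (a + real i * l) (a + real (Suc i) * l) \<and>
    mass (a + real i * l) (a + real (Suc i) * l) \<le> f n * A * l"
proof (intro exI[of _ "1 / f n"] conjI allI impI)
  have f: "f n > 0" using f_ge[OF n] eta by simp
  show "0 < 1 / f n" using f by simp
  fix i assume i: "i < n"
  show "1 / f n * l \<le> mass (a + real i * l) (a + real (Suc i) * l)" using M[OF i] f by (simp add: field_simps)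
  have "real (Suc i) * l \<le> real n * l" using i l by (intro mult_right_mono) auto
  then have "a + real (Suc i) * l \<le> 1" using a(2) by linarith
  then have "mass (a + real i * l) (a + real (Suc i) * l) \<le> (a + real (Suc i) * l) - (a + real i * l)"
    using a l by (intro mass_le) auto
  then show "mass (a + real i * l) (a + real (Suc i) * l) \<le> f n * (1 / f n) * l"
    using f by (simp add: algebra_simps)
qed

text \<open>Lower bounds on the children suffice if the parent starts at 0, meets no dip, meets a
  dip with \<open>N j \<le> n\<close>, or meets one that is short against a child. In the remaining
  case the parent is shorter than the grid point near the dip and lies on one side of it.\<close>

lemma children_comparable:
  fixes m k :: int
  assumes n: "2 \<le> n" and k: "1 \<le> k"
  defines "L \<equiv> real n powi (- m)"
  assumes kL: "of_int k * L \<le> 1"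
  defines "a \<equiv> of_int (k - 1) * L" and "l \<equiv> L / real n"
  shows "\<exists>A>0. \<forall>i<n. A * l \<le> mass (a + real i * l) (a + real (Suc i) * l) \<and>
    mass (a + real i * l) (a + real (Suc i) * l) \<le> f n * A * l"
proof -
  have L: "0 < L" using n by (simp add: L_def)
  have l: "0 < l" "real n * l = L" using L n by (auto simp: l_def)
  have a: "0 \<le> a" "a + real n * l \<le> 1" using k L kL l by (auto simp: a_def algebra_simps)
  define x where "x = (\<lambda>i::nat. a + real i * l)"
  have x: "0 \<le> x i" "x i \<le> x (Suc i)" "x (Suc i) \<le> 1" "x (Suc i) - x i = l" "a \<le> x i" "x (Suc i) \<le> a + L" if "i < n" for i
  proof -
    have "real (Suc i) * l \<le> real n * l" using that l by (intro mult_right_mono) auto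
    then show "x (Suc i) \<le> 1" "x (Suc i) \<le> a + L" using a l by (auto simp: x_def)
  qed (use a l in \<open>auto simp: x_def algebra_simps\<close>)
  have sub: "z \<in> {a..<a + L}" if "z \<in> {x i..<x (Suc i)}" "i < n" for z i
    using x(5,6)[OF that(2)] that(1) by auto
  have easy: ?thesis if "\<And>i. i < n \<Longrightarrow> l \<le> f n * mass (x i) (x (Suc i))"
    using children_comparable_no_dip[OF n l(1) a] that unfolding x_def by blast
  have no_dip: ?thesis if "\<And>z. z \<in> {a..<a + L} \<Longrightarrow> w z = 1"
  proof (rule easy)
    fix i assume i: "i < n"
    show "l \<le> f n * mass (x i) (x (Suc i))"
      using mass_no_dip[OF n x(1-3)[OF i] that[OF sub[OF _ i]]] x(4)[OF i] by simp
  qed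
  show ?thesis
  proof (cases "k = 1")
    case True
    then have "a = 0" by (simp add: a_def)
    then show ?thesis
      using mass_initial_child[OF n l(1)] a by (intro easy) (auto simp: x_def)
  next
    case False
    then have "1 * L \<le> a" using k L unfolding a_def by (intro mult_right_mono) auto
    then have La: "L \<le> a" by simp
    have "\<eta> * (a + L) \<le> 1 / 2 * (a + L)" using a L eta by (intro mult_right_mono) auto
    also have "\<dots> \<le> a" using La by simp
    finally have a_pos: "0 < a" "\<eta> * (a + L) \<le> a" using La L by simp_all
    show ?thesis
    proof (rule one_dip_cases[OF a_pos])
      fix j assume j: "{a..<a + L} \<inter> dip j \<noteq> {}" "\<And>z. z \<in> {a..<a + L} \<Longrightarrow> w z = V j (z / b j - 1)"
        "\<And>z. z \<in> {a..<a + L} \<Longrightarrow> z \<notin> dip j \<Longrightarrow> w z = 1"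
      show ?thesis
      proof (cases "N j \<le> n")
        case True
        show ?thesis
        proof (rule easy)
          fix i assume i: "i < n"
          show "l \<le> f n * mass (x i) (x (Suc i))"
            using mass_crude[OF True x(1-3)[OF i] j(2)[OF sub[OF _ i]]] x(4)[OF i] by simp
        qed
      next
        case n_small: False
        show ?thesis
        proof (cases "\<delta> j * b j \<le> \<eta> * l")
          case True
          show ?thesis
          proof (rule easy)
            fix i assume i: "i < n"
            show "l \<le> f n * mass (x i) (x (Suc i))"
              using mass_dip_negligible[OF n x(1-3)[OF i] _ j(3)[OF sub[OF _ i]]] True x(4)[OF i] by simp
          qed
        next
          case False
          obtain p :: int where p: "\<bar>real n powi (- p) / b j - 1\<bar> \<le> r j / 3"
            using b_grid[of n j] n n_small by auto
          define \<beta> where "\<beta> = real n powi (- p)"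
          have bj: "b j > 0" by (rule b_pos)
          have r: "r j \<le> 1 / 16" "r j > 0" using delta(3,4)[of j] r_pos by auto
          have \<beta>: "\<bar>\<beta> / b j - 1\<bar> \<le> r j / 3" "0 \<le> \<beta>" using p by (auto simp: \<beta>_def)
          have "1 / 2 < \<beta> / b j" using \<beta>(1) r by linarith
          then have \<beta>b: "b j / 2 < \<beta>" using bj by (simp add: field_simps)
          \<comment> \<open>A dip that is not short against a child forces
            \<open>L \<le> b j / 2\<close>, by the choice of
            \<open>\<delta> j * N j = \<eta> / 2\<close>.\<close>
          have "\<eta> * L = real n * (\<eta> * l)" using l by simp
          also have "\<dots> \<le> real (N j) * (\<eta> * l)" using n_small eta l by (intro mult_right_mono) auto
          also have "\<dots> \<le> real (N j) * (\<delta> j * b j)" using False by (intro mult_left_mono) auto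
          also have "\<dots> = (\<delta> j * real (N j)) * b j" by simp
          also have "\<dots> = \<eta> * (b j / 2)" unfolding delta(2) by simp
          finally have "L \<le> b j / 2" using eta by simp
          then have "L < \<beta>" using \<beta>b by simp
          \<comment> \<open>\<open>\<beta>\<close> is an integer multiple of \<open>L\<close>, so the parent interval lies on one side of \<open>\<beta>\<close>.\<close>
          have "p < m"
          proof (rule ccontr)
            assume "\<not> p < m"
            then have "\<beta> \<le> L" unfolding \<beta>_def L_def using n by (intro power_int_increasing) auto
            then show False using \<open>L < \<beta>\<close> by simp
          qed
          define M :: int where "M = int n ^ nat (m - p)"
          have "real n powi (- p) = real n powi ((m - p) + (- m))" by simp
          also have "\<dots> = real n powi (m - p) * L" unfolding L_def using n by (subst power_int_add) auto
          also have "real n powi (m - p) = of_int M" using \<open>p < m\<close> by (simp add: M_def power_int_def)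
          finally have beta_eq: "\<beta> = of_int M * L" by (simp add: \<beta>_def)
          show ?thesis
          proof (cases "k \<le> M")
            case True
            \<comment> \<open>To the left of \<open>\<beta>\<close> the profile is evaluated at
              arguments of at most \<open>r j / 3\<close>, where it is still 1. This covers the part
              of the dip between \<open>b j\<close> and \<open>\<beta>\<close>.\<close>
            show ?thesis
            proof (rule no_dip)
              fix z assume z: "z \<in> {a..<a + L}"
              have "a + L = of_int k * L" by (simp add: a_def algebra_simps)
              also have "\<dots> \<le> \<beta>" unfolding beta_eq using True L by (intro mult_right_mono) auto
              finally have "z / b j \<le> \<beta> / b j" using z bj by (intro divide_right_mono) auto
              then have "z / b j - 1 \<le> r j" using \<beta>(1) r by linarith
              then show "w z = 1" using j(2)[OF z] V_eq_1 by simp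
            qed
          next
            case False
            have ab: "a - \<beta> = of_int (k - 1 - M) * L" by (simp add: beta_eq a_def algebra_simps)
            \<comment> \<open>The distance \<open>a - \<beta>\<close> is a nonnegative integer
              multiple of the parent length: either 0 or at least that length.\<close>
            have "a = \<beta> \<or> real n * l \<le> a - \<beta>"
            proof (cases "k - 1 - M = 0")
              case True
              then show ?thesis using ab by simp
            next
              case ne: False
              then have "1 * L \<le> of_int (k - 1 - M) * L" using False L by (intro mult_right_mono) auto
              then show ?thesis using ab l by simp
            qed
            then show ?thesis
              using comparable_near_dip[OF n _ l(1) \<beta> _ a(2)] n_small j(2) l(2) by auto
          qed
        qed
      qed
    qed (rule no_dip)
  qed
qed

section \<open>Doubling for every \<open>n\<close>\<close>

lemma nadic_doubling: "2 \<le> n \<Longrightarrow> nadic_doubling_with n (f n) \<nu>"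
  unfolding nadic_doubling_with_def
proof (intro conjI allI impI)
  assume n: "2 \<le> n"
  show f: "0 < f n" using f_ge[OF n] eta by simp
  fix J1 J2 assume "nadic_siblings n J1 J2"
  then obtain m k i j where sub: "nadic_interval n m k \<subseteq> {0..<1}"
    and i: "i \<in> {1..n}" "J1 = nadic_child n m k i" and j: "j \<in> {1..n}" "J2 = nadic_child n m k j"
    unfolding nadic_siblings_def by blast
  define L where "L = real n powi (- m)"
  define a where "a = of_int (k - 1) * L"
  define l where "l = L / real n"
  have L: "0 < L" "1 / real n powi m = L" using n by (auto simp: L_def power_int_minus field_simps)
  have "1 / real n powi (m + 1) = (1 / real n powi m) / real n"
    using n by (simp add: power_int_add)
  then have l: "0 < l" "1 / real n powi (m + 1) = l" "real n * l = L"
    using n L(1) unfolding L(2) by (auto simp: l_def)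
  have "nadic_interval n m k = {a..<of_int k * L}"
    using L(2) by (simp add: nadic_interval_def a_def divide_inverse)
  \<comment> \<open>Nonemptiness allows the inclusion in \<open>[0, 1)\<close> to be read off at the
    end points.\<close>
  moreover have "a < of_int k * L" using L by (simp add: a_def algebra_simps)
  ultimately have a: "0 \<le> a" "of_int k * L \<le> 1" using sub by auto
  then have k: "1 \<le> k" using L by (auto simp: a_def zero_le_mult_iff)
  have aL: "a + L = of_int k * L" by (simp add: a_def algebra_simps)
  \<comment> \<open>Children are numbered from 1, whereas the mass estimates count them from
    0.\<close>
  have child: "nadic_child n m k (Suc i) = {a + real i * l..<a + real (Suc i) * l}" for i
    using L(2) l(2) by (simp add: nadic_child_def a_def divide_inverse)
  have em: "emeasure \<nu> (nadic_child n m k (Suc i)) = ennreal (mass (a + real i * l) (a + real (Suc i) * l))" if "i < n" for i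
  proof -
    have "real (Suc i) * l \<le> real n * l" using that l by (intro mult_right_mono) auto
    then show ?thesis unfolding child using a l aL by (intro emeasure_mass) auto
  qed
  have "\<exists>A>0. \<forall>i<n. A * l \<le> mass (a + real i * l) (a + real (Suc i) * l) \<and>
      mass (a + real i * l) (a + real (Suc i) * l) \<le> f n * A * l"
    using a(2) unfolding l_def a_def L_def by (rule children_comparable[OF n k])
  then obtain A where A: "A > 0" "\<And>i. i < n \<Longrightarrow> A * l \<le> mass (a + real i * l) (a + real (Suc i) * l)"
    "\<And>i. i < n \<Longrightarrow> mass (a + real i * l) (a + real (Suc i) * l) \<le> f n * A * l"
    by blast
  obtain i' j' where ij: "i = Suc i'" "j = Suc j'" "i' < n" "j' < n" using i j by (cases i; cases j) auto
  have "mass (a + real i' * l) (a + real (Suc i') * l) \<le> f n * (A * l)" using A(3)[OF ij(3)] by simp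
  also have "\<dots> \<le> f n * mass (a + real j' * l) (a + real (Suc j') * l)"
    using A(2)[OF ij(4)] f by (intro mult_left_mono) auto
  finally show "emeasure \<nu> J1 \<le> ennreal (f n) * emeasure \<nu> J2"
    unfolding i j ij em[OF ij(3)] em[OF ij(4)] using f mass_nonneg
    by (subst ennreal_mult[symmetric]) (auto intro: ennreal_leI)
qed

section \<open>Failure of doubling\<close>

lemma adjacent_dip_ratio:
  obtains I J where "I \<subseteq> {0..<1}" "J \<subseteq> {0..<1}" "adjacent_equal_length I J"
    "0 < measure \<nu> I" "emeasure \<nu> I = ennreal (measure \<nu> I)" "emeasure \<nu> J = ennreal (measure \<nu> J)"
    "K k / 2 * measure \<nu> J \<le> measure \<nu> I"
proof -
  \<comment> \<open>The right interval \<open>[b k, b k + d)\<close> ends at the lowest point of the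
    dip, where the profile is \<open>1 / K k\<close>.\<close>
  define d where "d = c k * b k"
  have bk: "0 < b k" "b k \<le> 1 / 2" using b_pos b_le_half by auto
  have c: "0 < c k" "c k \<le> 1 / 16" using r_pos[of k] r_le_c[of k] delta(3,5)[of k] by auto
  have d: "0 < d" "d \<le> b k / 2" using c bk mult_right_mono[of "c k" "1 / 2" "b k"] by (auto simp: d_def)
  \<comment> \<open>Dips of smaller index lie to the right of \<open>b k\<close>, those of larger
    index below \<open>\<eta> * b k\<close>, hence to the left of \<open>b k - d\<close>.\<close>
  have left: "w z = 1" if z: "z \<in> {b k - d..<b k}" for z
  proof (rule w_out)
    fix j show "z \<notin> dip j"
    proof
      assume zj: "z \<in> dip j"
      have bk_dip: "b k \<in> dip k" using bk delta(1)[of k] by (auto simp: dip_def)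
      consider "j = k" | "j < k" | "k < j" by linarith
      then show False
      proof cases
        case 1
        then show ?thesis using zj z by (auto simp: dip_def)
      next
        case 2
        have "b k < \<eta> * z" by (rule dip_separated[OF 2 zj bk_dip])
        also have "\<dots> \<le> 1 * z" using eta dip_pos[OF zj] by (intro mult_right_mono) auto
        finally show ?thesis using z by auto
      next
        case 3
        have "z < \<eta> * b k" by (rule dip_separated[OF 3 bk_dip zj])
        also have "\<dots> \<le> 1 / 2 * b k" using eta bk by (intro mult_right_mono) auto
        finally show ?thesis using z d by auto
      qed
    qed
  qed
  have "1 * (b k - (b k - d)) \<le> mass (b k - d) (b k)" using left d bk by (intro mass_lower) auto
  then have I: "d \<le> mass (b k - d) (b k)" by simp
  have right: "w z = V k (z / b k - 1)" if z: "z \<in> {b k..<b k + d}" for z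
  proof (rule w_dip)
    have "d \<le> \<delta> k * b k" unfolding d_def using delta(5)[of k] bk by (intro mult_right_mono) auto
    then show "z \<in> dip k" using z by (auto simp: dip_def)
  qed
  have "mass (b k) (b k + d) \<le> (1 + 2 * \<eta>) * V k ((b k + d) / b k - 1) * d"
    using mass_near_dip(1)[of "b k" k d] right bk d r_pos[of k] by simp
  also have "(b k + d) / b k - 1 = c k" using bk by (simp add: d_def field_simps)
  also have "(1 + 2 * \<eta>) * V k (c k) * d \<le> 2 * (1 / K k) * d"
    unfolding V_c using eta K_ge[of k] d by (intro mult_right_mono) auto
  finally have "K k / 2 * mass (b k) (b k + d) \<le> d" using K_ge[of k] by (simp add: field_simps)
  then have "K k / 2 * mass (b k) (b k + d) \<le> mass (b k - d) (b k)" using I by simp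
  moreover have "adjacent_equal_length {b k - d..<b k} {b k..<b k + d}"
    unfolding adjacent_equal_length_def using d
    by (intro exI[of _ "b k - d"] exI[of _ "b k"] exI[of _ "b k + d"]) auto
  moreover have "{b k - d..<b k} \<subseteq> {0..<1}" "{b k..<b k + d} \<subseteq> {0..<1}" using d bk by auto
  moreover have "emeasure \<nu> {b k - d..<b k} = ennreal (mass (b k - d) (b k))"
    "emeasure \<nu> {b k..<b k + d} = ennreal (mass (b k) (b k + d))"
    using d bk by (auto intro!: emeasure_mass)
  moreover have "0 < mass (b k - d) (b k)" using I d by simp
  ultimately show ?thesis using that unfolding mass_def by blast
qed

lemma not_doubling:
  assumes "\<And>C. \<exists>k. C < K k"
  shows "\<not> doubling \<nu>"
proof
  assume "doubling \<nu>"
  then obtain C where C: "C > 0" "\<And>I J. I \<subseteq> {0..<1} \<Longrightarrow> J \<subseteq> {0..<1} \<Longrightarrow> adjacent_equal_length I J \<Longrightarrow>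
    emeasure \<nu> I \<le> ennreal C * emeasure \<nu> J" unfolding doubling_def by blast
  obtain k where k: "2 * C < K k" using assms by blast
  obtain I J where IJ: "I \<subseteq> {0..<1}" "J \<subseteq> {0..<1}" "adjacent_equal_length I J" "0 < measure \<nu> I"
    "emeasure \<nu> I = ennreal (measure \<nu> I)" "emeasure \<nu> J = ennreal (measure \<nu> J)"
    "K k / 2 * measure \<nu> J \<le> measure \<nu> I"
    by (rule adjacent_dip_ratio)
  have "ennreal (measure \<nu> I) \<le> ennreal (C * measure \<nu> J)"
    using C(2)[OF IJ(1-3)] C(1) unfolding IJ(5,6) by (simp add: ennreal_mult)
  then have le: "measure \<nu> I \<le> C * measure \<nu> J" using C(1) by (simp add: ennreal_le_iff)
  then have pos: "0 < measure \<nu> J" using IJ(4) C(1) by (metis less_le_trans zero_less_mult_pos)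
  have "K k / 2 * measure \<nu> J \<le> C * measure \<nu> J" using le IJ(7) by simp
  then show False using pos k by simp
qed

end

section \<open>Existence\<close>

text \<open>Scaling preserves all ratios of masses, so a single measure yields an infinite
  family.\<close>

lemma doubling_scale_measure_iff:
  assumes "0 < s"
  shows "doubling (scale_measure (ennreal s) \<mu>) \<longleftrightarrow> doubling \<mu>"
  unfolding doubling_def using assms by (simp add: mult.left_commute[of _ "ennreal s"] ennreal_mult_le_mult_iff)

lemma nadic_doubling_with_scale_measure:
  "nadic_doubling_with n C \<mu> \<Longrightarrow> nadic_doubling_with n C (scale_measure s \<mu>)"
  unfolding nadic_doubling_with_def by (auto simp: mult.left_commute[of _ s] intro!: mult_left_mono)

text \<open>The order of the choices matters: \<open>\<eta>\<close> depends on \<open>f 2\<close>,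
  then \<open>N k\<close> on the growth of \<open>f\<close>, then the profile with
  \<open>r k\<close> on \<open>N k\<close>, and finally \<open>b k\<close> on the accuracy
  \<open>r k\<close> and on its predecessor.\<close>

lemma exists_dips:
  fixes f :: "nat \<Rightarrow> real"
  assumes f1: "\<And>n. n \<ge> 2 \<Longrightarrow> f n > 1"
    and mono: "mono_on {2..} f"
    and unb: "\<not> bdd_above (f ` {2..})"
  shows "\<exists>\<eta> N r c b V. dips \<eta> f N (\<lambda>k. real k + 1) r c b V"
proof -
  \<comment> \<open>By monotonicity, \<open>8 * \<eta> \<le> f 2 - 1\<close> gives
    \<open>1 + 8 * \<eta> \<le> f n\<close> for every \<open>n \<ge> 2\<close>.\<close>
  define \<eta> where "\<eta> = min (1 / 4) ((f 2 - 1) / 8)"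
  have eta: "0 < \<eta>" "\<eta> \<le> 1 / 4" using f1[of 2] by (auto simp: \<eta>_def)
  have eta_f: "\<eta> \<le> (f 2 - 1) / 8" unfolding \<eta>_def by (rule min.cobounded2)
  have "\<exists>m\<ge>2. \<forall>n\<ge>m. B \<le> f n" for B
  proof -
    obtain m where m: "m \<ge> 2" "B < f m" using unb unfolding bdd_above_def by (auto simp: not_le)
    then have "\<forall>n\<ge>m. B \<le> f n" using mono_onD[OF mono, of m] by (auto intro: order_trans[OF less_imp_le])
    then show ?thesis using m by blast
  qed
  then have "\<forall>k::nat. \<exists>m. 2 \<le> m \<and> (\<forall>n\<ge>m. real k + 1 \<le> f n)" by blast
  from choice[OF this] obtain N where N: "\<And>k::nat. 2 \<le> N k" "\<And>k n. N k \<le> n \<Longrightarrow> real k + 1 \<le> f n"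
    by blast
  define Q where "Q = (\<lambda>k r c V. 0 < r \<and> r \<le> c \<and> c \<le> \<eta> / (2 * real (N k)) \<and> V \<in> borel_measurable borel \<and>
    (\<forall>t. 1 / (real k + 1) \<le> V t) \<and> (\<forall>t. V t \<le> 1) \<and> (\<forall>t. t \<le> r \<or> \<eta> / (2 * real (N k)) \<le> t \<longrightarrow> V t = 1) \<and>
    V c = 1 / (real k + 1) \<and>
    (\<forall>\<sigma> x y. \<bar>\<sigma>\<bar> \<le> r / 3 \<longrightarrow> 0 < x \<longrightarrow> x \<le> y \<longrightarrow> y \<le> real (N k) * (real k + 1) / \<eta> * x \<longrightarrow>
       V (y + \<sigma>) \<le> (1 + \<eta>) * V (x + \<sigma>) \<and> V (x + \<sigma>) \<le> (1 + \<eta>) * V (y + \<sigma>)))"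
  have "\<exists>r c V. Q k r c V" for k
  proof -
    have K1: "1 \<le> real k + 1" by simp
    have N2: "real (N k) \<ge> 2" using N(1)[of k] by linarith
    then have "2 * 1 \<le> real (N k) * (real k + 1)" by (intro mult_mono) auto
    then have Lam: "1 < real (N k) * (real k + 1) / \<eta>" using eta by (simp add: field_simps)
    have del: "0 < \<eta> / (2 * real (N k))" using eta N2 by simp
    show ?thesis
      by (rule slowly_varying_profile[OF eta(1) K1 Lam del]) (unfold Q_def, blast)
  qed
  then obtain r c V where V: "\<And>k. Q k (r k) (c k) (V k)" by metis
  define P where "P = (\<lambda>k b. 0 < b \<and> b \<le> 1 / 2 \<and>
    (\<forall>n. 2 \<le> n \<longrightarrow> n < N k \<longrightarrow> (\<exists>p::int. \<bar>real n powi (- p) / b - 1\<bar> \<le> r k / 3)))"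
  have step: "\<exists>b. P k b \<and> b \<le> B" if B: "0 < B" for k B
  proof -
    have "0 < r k / 3" "0 < min B (1 / 2)" using V[of k] B by (auto simp: Q_def)
    then show ?thesis by (rule exists_point_near_powers[where N = "N k"]) (auto simp: P_def)
  qed
  \<comment> \<open>Dependent choice, since the bound on \<open>b (Suc k)\<close> involves the
    chosen \<open>b k\<close>.\<close>
  have "\<exists>b. \<forall>k. P k (b k) \<and> b (Suc k) \<le> \<eta> / 2 * b k"
  proof (rule dependent_nat_choice)
    show "\<exists>b. P 0 b" using step[of 1 0] by auto
    show "\<exists>b'. P (Suc k) b' \<and> b' \<le> \<eta> / 2 * b" if "P k b" for k b
      using that eta by (intro step) (auto simp: P_def)
  qed
  then obtain b where b: "\<And>k. P k (b k)" "\<And>k. b (Suc k) \<le> \<eta> / 2 * b k" by blast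
  have "dips \<eta> f N (\<lambda>k. real k + 1) r c b V"
  proof unfold_locales
    show "1 + 8 * \<eta> \<le> f n" if "2 \<le> n" for n using mono_onD[OF mono, of 2 n] that eta_f by simp
    show "1 \<le> real k + 1" for k by simp
  qed (use eta N V[unfolded Q_def] b[unfolded P_def] in \<open>blast+\<close>)
  then show ?thesis by blast
qed

theorem theorem4p5:
  fixes f :: "nat \<Rightarrow> real"
  assumes "\<And>n. n \<ge> 2 \<Longrightarrow> f n > 1"
    and "mono_on {2..} f"
    and "\<not> bdd_above (f ` {2..})"
  shows "\<exists>\<M> :: real measure set. infinite \<M> \<and>
    (\<forall>\<mu>\<in>\<M>. measure_on_unit \<mu> \<and>
       (\<forall>n\<ge>2. \<exists>C\<le>f n. nadic_doubling_with n C \<mu>) \<and>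
       \<not> doubling \<mu>)"
proof -
  obtain \<eta> N r c b V where d: "dips \<eta> f N (\<lambda>k. real k + 1) r c b V"
    using exists_dips[OF assms] by blast
  interpret dips \<eta> f N "\<lambda>k. real k + 1" r c b V by (rule d)
  define \<M> where "\<M> = (\<lambda>i. scale_measure (ennreal (real (Suc i))) \<nu>) ` UNIV"
  \<comment> \<open>A set of finite positive measure tells the multiples of \<open>\<nu>\<close>
    apart.\<close>
  obtain I where I: "0 < measure \<nu> I" "emeasure \<nu> I = ennreal (measure \<nu> I)"
    by (rule adjacent_dip_ratio)
  have "inj (\<lambda>i. scale_measure (ennreal (real (Suc i))) \<nu>)"
  proof (rule injI)
    fix i j assume "scale_measure (ennreal (real (Suc i))) \<nu> = scale_measure (ennreal (real (Suc j))) \<nu>"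
    then have "measure (scale_measure (ennreal (real (Suc i))) \<nu>) I = measure (scale_measure (ennreal (real (Suc j))) \<nu>) I"
      by (rule arg_cong)
    then have "real (Suc i) * measure \<nu> I = real (Suc j) * measure \<nu> I" by (simp del: of_nat_Suc)
    then show "i = j" using I(1) by simp
  qed
  then have "infinite \<M>" unfolding \<M>_def by (rule range_inj_infinite)
  moreover have "\<not> doubling \<nu>"
  proof (rule not_doubling)
    show "\<exists>k. C < real k + 1" for C using reals_Archimedean2[of C] by (metis add.commute less_add_one less_trans)
  qed
  ultimately show ?thesis
    using nadic_doubling sets_nu
    by (intro exI[of _ \<M>]) (auto simp: \<M>_def measure_on_unit_def doubling_scale_measure_iff
        intro!: nadic_doubling_with_scale_measure simp del: of_nat_Suc)
qed

end
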